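(* Let $\mathbf{X}$ be a random variable with values in $\mathbb{Z}$ whose characteristic function $\Phi_{\mathbf{X}}$ has no zeros, and let $\{\hat{c}_{\mathbf{X}}[n]\}_{n\in\mathbb{Z}}$ be its complex muculants. If $\mathbf{X}$ is Poisson distributed with parameter $\lambda>0$, then $\hat{c}_{\mathbf{X}}[0]=-\lambda$, $\hat{c}_{\mathbf{X}}[1]=\lambda$, and $\hat{c}_{\mathbf{X}}[n]=0$ for all $n\in\mathbb{Z}\setminus\{0,1\}$. Moreover, the Poisson distribution is the only distribution for which only the first two muculants are nonzero: if $\hat{c}_{\mathbf{X}}[0]\neq 0$, $\hat{c}_{\mathbf{X}}[1]\neq 0$ and $\hat{c}_{\mathbf{X}}[n]=0$ for all $n\in\mathbb{Z}\setminus\{0,1\}$, then $\mathbf{X}$ is Poisson distributed with some parameter $\lambda>0$.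
   Context: $\jmath$ denotes the imaginary unit. For a random variable $\mathbf{X}$ with values in $\mathbb{Z}$, the characteristic function is $\Phi_{\mathbf{X}}(\mu)=\mathbb{E}(e^{\jmath\mu\mathbf{X}})$, $\mu\in\mathbb{R}$. The complex logarithm of $\Phi_{\mathbf{X}}$ is $\log\Phi_{\mathbf{X}}(\mu)=\ln|\Phi_{\mathbf{X}}(\mu)|+\jmath\arg^*(\Phi_{\mathbf{X}}(\mu))$, where $\ln$ is the natural logarithm and $\mu\mapsto\arg^*(\Phi_{\mathbf{X}}(\mu))$ is the continuous (unwrapped) phase of $\Phi_{\mathbf{X}}$, normalized to be $0$ at $\mu=0$ (where $\Phi_{\mathbf{X}}(0)=1$). The complex muculants $\{\hat{c}_{\mathbf{X}}[n]\}_{n\in\mathbb{Z}}$ are the Fourier series coefficients of $\log\Phi_{\mathbf{X}}$ on $[-\pi,\pi]$: $$\hat{c}_{\mathbf{X}}[n]=\frac{1}{2\pi}\int_{-\pi}^{\pi}\log\Phi_{\mathbf{X}}(\mu)\,e^{-\jmath\mu n}\,\mathrm{d}\mu .$$ The Poisson distribution with parameter $\lambda>0$ has $\mathbb{P}(\mathbf{X}=\xi)=e^{-\lambda}\lambda^{\xi}/\xi!$ for integers $\xi\ge 0$, and $0$ otherwise. The "first two" muculants are those with index $n=0$ and $n=1$. *)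

theory Defs
  imports "HOL-Probability.Probability"
begin

definition char_fun :: "'a measure \<Rightarrow> ('a \<Rightarrow> int) \<Rightarrow> real \<Rightarrow> complex" where
  "char_fun M X = char (distr M borel (\<lambda>\<omega>. real_of_int (X \<omega>)))"

lemma char_fun_eq_expectation:
  assumes "X \<in> M \<rightarrow>\<^sub>M count_space UNIV"
  shows "char_fun M X \<mu> = (CLINT \<omega>|M. exp (\<i> * of_real \<mu> * of_int (X \<omega>)))"
proof -
  have [measurable]: "(\<lambda>\<omega>. real_of_int (X \<omega>)) \<in> borel_measurable M"
    using assms by measurable
  show ?thesis
    unfolding char_fun_def char_def
    by (subst integral_distr) (simp_all add: mult.assoc)
qed

(* Well-defined for every continuous zero-free \<Phi> with \<Phi> 0 = 1, see ex1_unwrapped_phase. *)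
definition is_unwrapped_phase :: "(real \<Rightarrow> complex) \<Rightarrow> (real \<Rightarrow> real) \<Rightarrow> bool" where
  "is_unwrapped_phase \<Phi> \<theta> \<longleftrightarrow>
     continuous_on UNIV \<theta> \<and> \<theta> 0 = 0 \<and> (\<forall>\<mu>. \<Phi> \<mu> = of_real (cmod (\<Phi> \<mu>)) * cis (\<theta> \<mu>))"

definition unwrapped_phase :: "(real \<Rightarrow> complex) \<Rightarrow> real \<Rightarrow> real" where
  "unwrapped_phase \<Phi> = (THE \<theta>. is_unwrapped_phase \<Phi> \<theta>)"

lemma is_unwrapped_phase_unique:
  assumes nz: "\<And>\<mu>. \<Phi> \<mu> \<noteq> 0"
    and \<theta>: "is_unwrapped_phase \<Phi> \<theta>" and \<eta>: "is_unwrapped_phase \<Phi> \<eta>"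
  shows "\<theta> = \<eta>"
proof
  fix \<mu>
  define d where "d = (\<lambda>\<mu>. (\<theta> \<mu> - \<eta> \<mu>) / (2 * pi))"
  have cont: "continuous_on UNIV d"
    using \<theta> \<eta> unfolding is_unwrapped_phase_def d_def by (auto intro!: continuous_intros)
  have int: "d x \<in> \<int>" for x
  proof -
    have "of_real (cmod (\<Phi> x)) * cis (\<theta> x) = of_real (cmod (\<Phi> x)) * cis (\<eta> x)"
      using \<theta> \<eta> unfolding is_unwrapped_phase_def by metis
    then have "cis (\<theta> x) = cis (\<eta> x)" using nz[of x] by simp
    then have "cis (\<theta> x - \<eta> x) = 1" by (simp flip: cis_divide)
    then have "cos (\<theta> x - \<eta> x) = 1" by (metis cis.sel(1) one_complex.sel(1))
    then obtain k :: int where "\<theta> x - \<eta> x = of_int k * 2 * pi"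
      by (auto simp: cos_one_2pi_int)
    then have "d x = of_int k" by (simp add: d_def)
    then show ?thesis by simp
  qed
  have "d constant_on UNIV"
  proof (rule continuous_discrete_range_constant)
    show "connected (UNIV :: real set)" by simp
    show "continuous_on UNIV d" by (rule cont)
    fix x :: real
    have "1 \<le> norm (d y - d x)" if "d y \<noteq> d x" for y
    proof -
      have "d y - d x \<in> \<int>" using int by simp
      with that show ?thesis by (simp add: Ints_nonzero_abs_ge1)
    qed
    then show "\<exists>e>0. \<forall>y. y \<in> UNIV \<and> d y \<noteq> d x \<longrightarrow> e \<le> norm (d y - d x)"
      by (intro exI[of _ 1]) auto
  qed
  then have "d \<mu> = d 0" by (auto simp: constant_on_def)
  moreover have "d 0 = 0" using \<theta> \<eta> by (simp add: d_def is_unwrapped_phase_def)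
  ultimately show "\<theta> \<mu> = \<eta> \<mu>" by (simp add: d_def)
qed

lemma ex1_unwrapped_phase:
  assumes cont: "continuous_on UNIV \<Phi>" and nz: "\<And>\<mu>. \<Phi> \<mu> \<noteq> 0" and one: "\<Phi> 0 = 1"
  shows "\<exists>!\<theta>. is_unwrapped_phase \<Phi> \<theta>"
proof -
  have "contractible (UNIV :: real set)" by (simp add: convex_imp_contractible)
  then obtain g where g: "continuous_on UNIV g" "\<And>x. \<Phi> x = exp (g x)"
    using continuous_logarithm_on_contractible[OF cont] nz by auto
  have "exp (g 0) = 1" using g(2)[of 0] one by simp
  then have "Re (g 0) = 0" by (metis norm_exp_eq_Re norm_one exp_eq_one_iff)
  with \<open>exp (g 0) = 1\<close> have Im0: "cis (Im (g 0)) = 1" by (simp add: exp_eq_polar)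
  have "is_unwrapped_phase \<Phi> (\<lambda>\<mu>. Im (g \<mu>) - Im (g 0))"
    unfolding is_unwrapped_phase_def
    using g(1) by (auto intro!: continuous_intros simp: g(2) exp_eq_polar norm_mult Im0 simp flip: cis_divide)
  then show ?thesis using is_unwrapped_phase_unique[of \<Phi>] nz by (intro ex_ex1I) blast+
qed

definition log_char_fun :: "'a measure \<Rightarrow> ('a \<Rightarrow> int) \<Rightarrow> real \<Rightarrow> complex" where
  "log_char_fun M X \<mu> =
     of_real (ln (cmod (char_fun M X \<mu>))) + \<i> * of_real (unwrapped_phase (char_fun M X) \<mu>)"

definition muculant :: "'a measure \<Rightarrow> ('a \<Rightarrow> int) \<Rightarrow> int \<Rightarrow> complex" where
  "muculant M X n =
     1 / (2 * of_real pi) *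
       (CLINT \<mu>:{-pi..pi}|lborel. log_char_fun M X \<mu> * exp (- (\<i> * of_real \<mu> * of_int n)))"

lemma ex1_unwrapped_phase_char_fun:
  assumes "prob_space M" and X: "X \<in> M \<rightarrow>\<^sub>M count_space UNIV"
    and nz: "\<And>\<mu>. char_fun M X \<mu> \<noteq> 0"
  shows "\<exists>!\<theta>. is_unwrapped_phase (char_fun M X) \<theta>"
proof -
  interpret prob_space M by fact
  have "(\<lambda>\<omega>. real_of_int (X \<omega>)) \<in> borel_measurable M" using X by measurable
  then interpret D: real_distribution "distr M borel (\<lambda>\<omega>. real_of_int (X \<omega>))"
    by (rule real_distribution_distr)
  show ?thesis
    using nz D.char_zero D.isCont_char
    by (intro ex1_unwrapped_phase) (auto simp: char_fun_def continuous_at_imp_continuous_on)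
qed

definition poisson_distributed :: "'a measure \<Rightarrow> ('a \<Rightarrow> int) \<Rightarrow> real \<Rightarrow> bool" where
  "poisson_distributed M X rate \<longleftrightarrow>
     rate > 0 \<and> distr M (count_space UNIV) X = measure_pmf (map_pmf int (poisson_pmf rate))"

lemma poisson_distributed_iff:
  assumes "prob_space M" and X: "X \<in> M \<rightarrow>\<^sub>M count_space UNIV"
  shows "poisson_distributed M X rate \<longleftrightarrow> rate > 0 \<and>
    (\<forall>\<xi>. measure M {\<omega> \<in> space M. X \<omega> = \<xi>} =
       (if \<xi> \<ge> 0 then exp (- rate) * rate ^ nat \<xi> / fact (nat \<xi>) else 0))"
proof (cases "rate > 0")
  case True
  interpret prob_space M by fact
  let ?D = "distr M (count_space UNIV) X" and ?p = "map_pmf int (poisson_pmf rate)"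
  have D: "measure ?D {\<xi>} = measure M {\<omega> \<in> space M. X \<omega> = \<xi>}" for \<xi>
    using X by (subst measure_distr) (auto intro!: arg_cong[where f = "measure M"])
  have p: "measure ?p {\<xi>} = (if \<xi> \<ge> 0 then exp (- rate) * rate ^ nat \<xi> / fact (nat \<xi>) else 0)" for \<xi>
  proof (cases "\<xi> \<ge> 0")
    case nonneg: True
    then have "pmf ?p (int (nat \<xi>)) = pmf (poisson_pmf rate) (nat \<xi>)"
      by (intro pmf_map_inj') (auto simp: inj_def)
    with nonneg True show ?thesis by (simp add: measure_pmf_single mult.commute)
  next
    case False
    then have "pmf ?p \<xi> = 0" by (auto simp: pmf_eq_0_set_pmf)
    with False show ?thesis by (simp add: measure_pmf_single)
  qed
  interpret D: prob_space ?D using X by (rule prob_space_distr)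
  have "?D = measure_pmf ?p \<longleftrightarrow> (\<forall>\<xi>. measure ?D {\<xi>} = measure ?p {\<xi>})"
    by (auto intro!: measure_eqI_countable[where A = UNIV]
        simp: D.emeasure_eq_measure measure_pmf.emeasure_eq_measure)
  then show ?thesis using True by (simp only: poisson_distributed_def D p)
qed (simp add: poisson_distributed_def)

end

theory Submission
  imports Defs
begin

text \<open>
  The characteristic function of a Poisson variable with parameter \<open>\<lambda>\<close> is
  \<open>exp (\<lambda> (e\<^sup>i\<^sup>\<mu> - 1))\<close>. The exponent is continuous and vanishes at \<open>0\<close>, so it is the
  logarithm with the unwrapped phase (\<open>log_char_fun_eqI\<close>); being a trigonometric polynomial,
  it displays its own Fourier coefficients \<open>-\<lambda>\<close> and \<open>\<lambda>\<close>.

  For the converse, let \<open>a\<close> and \<open>b\<close> be the muculants with index \<open>0\<close> and \<open>1\<close>. The continuous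
  functions \<open>log \<Phi>\<close> and \<open>a + b e\<^sup>i\<^sup>\<mu>\<close> have the same Fourier coefficients on \<open>[-\<pi>, \<pi>]\<close>, hence
  agree there (\<open>null_fourier_coeffs_imp_zero\<close>). From \<open>log \<Phi>(0) = 0\<close> follows \<open>a = -b\<close>, so
  \<open>\<Phi>(\<mu>) = exp (b (e\<^sup>i\<^sup>\<mu> - 1))\<close> on \<open>[-\<pi>, \<pi>]\<close>, and on all of \<open>\<real>\<close> because \<open>\<Phi>\<close> is periodic, the
  variable being integer valued. Two elementary facts locate \<open>b\<close>: the symmetry
  \<open>|\<Phi>(-\<mu>)| = |\<Phi>(\<mu>)|\<close> at \<open>\<pi>/2\<close> makes \<open>b\<close> real, and \<open>|\<Phi>(\<pi>)| = exp (-2 b) \<le> 1\<close> makes it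
  nonnegative. As \<open>b \<noteq> 0\<close>, \<open>\<Phi>\<close> is the characteristic function of a Poisson distribution,
  and Levy's uniqueness theorem identifies the distribution.
\<close>

section \<open>Uniqueness of Fourier coefficients on an interval\<close>

text \<open>
  Only continuity on the closed interval is demanded, and not \<open>f (-\<pi>) = f \<pi>\<close>: that the
  logarithm of a characteristic function takes the same value at both ends is not known in
  advance, since the unwrapped phase may gain a multiple of \<open>2\<pi>\<close> along a period.
\<close>
definition null_fourier_coeffs :: "(real \<Rightarrow> complex) \<Rightarrow> bool" where
  "null_fourier_coeffs f \<longleftrightarrow> continuous_on {-pi..pi} f \<and>
     (\<forall>n::int. integral {-pi..pi} (\<lambda>x. f x * cis (of_int n * x)) = 0)"

lemma continuous_on_times_cis:
  assumes "continuous_on S f"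
  shows "continuous_on S (\<lambda>x. f x * cis (of_int n * x))"
  using assms by (intro continuous_intros)

lemma null_fourier_coeffs_add:
  assumes "null_fourier_coeffs f" "null_fourier_coeffs g"
  shows "null_fourier_coeffs (\<lambda>x. f x + g x)"
proof -
  have "continuous_on {-pi..pi} f" "continuous_on {-pi..pi} g"
    using assms by (auto simp: null_fourier_coeffs_def)
  then show ?thesis
    using assms unfolding null_fourier_coeffs_def
    by (auto simp: distrib_right continuous_on_add
        Henstock_Kurzweil_Integration.integral_add integrable_continuous_real continuous_on_times_cis)
qed

lemma null_fourier_coeffs_scale:
  assumes "null_fourier_coeffs f"
  shows "null_fourier_coeffs (\<lambda>x. c * f x)"
  using assms unfolding null_fourier_coeffs_def
  by (auto simp: mult.assoc intro: continuous_on_mult_left)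

lemma null_fourier_coeffs_shift:
  assumes "null_fourier_coeffs f"
  shows "null_fourier_coeffs (\<lambda>x. f x * cis (of_int k * x))"
proof -
  have "f x * cis (of_int k * x) * cis (of_int n * x) = f x * cis (of_int (k + n) * x)" for n x
    by (simp add: mult.assoc cis_mult distrib_right)
  then show ?thesis
    using assms unfolding null_fourier_coeffs_def by (simp only: continuous_on_times_cis) simp
qed

text \<open>
  The functions whose multiplication preserves vanishing coefficients form an algebra. It
  contains \<open>cos\<close> and \<open>sin\<close>, because these combine the shifts by \<open>1\<close> and \<open>-1\<close>; so it contains
  every polynomial in them. Quantifying over \<open>f\<close> makes products immediate and avoids
  expanding trigonometric polynomials.
\<close>
lemma null_fourier_coeffs_mult_real_poly:
  assumes "real_polynomial_function p" "null_fourier_coeffs f"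
  shows "null_fourier_coeffs (\<lambda>x. of_real (p (cis x)) * f x)"
  using assms
proof (induction arbitrary: f)
  case (linear p)
  define w where "w = Complex (p 1 / 2) (- p \<i> / 2)"
  have "p z = Re z * p 1 + Im z * p \<i>" for z
  proof -
    have "p z = p (Re z *\<^sub>R 1 + Im z *\<^sub>R \<i>)"
      by (rule arg_cong[where f = p]) (simp add: complex_eq_iff)
    also have "\<dots> = Re z * p 1 + Im z * p \<i>"
      using linear(1) by (simp only: linear_simps) simp
    finally show ?thesis .
  qed
  from this[of "cis _"] have "of_real (p (cis x)) * f x
      = w * (f x * cis (of_int 1 * x)) + cnj w * (f x * cis (of_int (-1) * x))" for x
    by (simp only:) (simp add: w_def complex_eq_iff algebra_simps)
  then show ?case
    by (simp only:) (intro null_fourier_coeffs_add null_fourier_coeffs_scale null_fourier_coeffs_shift linear.prems)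
next
  case (const c)
  then show ?case by (rule null_fourier_coeffs_scale)
next
  case (add p q)
  show ?case
    using null_fourier_coeffs_add[OF add.IH[OF add.prems]] by (simp add: distrib_right)
next
  case (mult p q)
  show ?case
    using mult.IH(1)[OF mult.IH(2)[OF mult.prems]] by (simp add: mult.assoc)
qed

lemma null_fourier_coeffs_mult_poly:
  fixes g :: "complex \<Rightarrow> complex"
  assumes "polynomial_function g" "null_fourier_coeffs f"
  shows "null_fourier_coeffs (\<lambda>x. g (cis x) * f x)"
proof -
  have "real_polynomial_function (Re \<circ> g)" "real_polynomial_function (Im \<circ> g)"
    using assms(1) bounded_linear_Re bounded_linear_Im by (auto simp: polynomial_function_def)
  then have "null_fourier_coeffs (\<lambda>x. of_real ((Re \<circ> g) (cis x)) * f x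
      + \<i> * (of_real ((Im \<circ> g) (cis x)) * f x))"
    by (intro null_fourier_coeffs_add null_fourier_coeffs_scale null_fourier_coeffs_mult_real_poly assms(2))
  moreover have "of_real ((Re \<circ> g) (cis x)) * f x
      + \<i> * (of_real ((Im \<circ> g) (cis x)) * f x) = g (cis x) * f x" for x
    by (simp add: complex_eq_iff)
  ultimately show ?thesis by simp
qed

text \<open>
  A function on \<open>[-\<pi>, \<pi>]\<close> with different values at the two ends does not descend to the
  circle. The factor \<open>1 + cos\<close> repairs this: it vanishes only at the point \<open>-1\<close>, where \<open>Arg\<close>
  jumps, and \<open>f\<close> is bounded there.
\<close>
lemma continuous_on_damped_transfer:
  fixes f :: "real \<Rightarrow> complex"
  assumes f: "continuous_on {-pi..pi} f"
  shows "continuous_on (sphere 0 1) (\<lambda>z. f (Arg z) * of_real (1 + Re z))" (is "continuous_on _ ?H")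
proof (unfold continuous_on_eq_continuous_within, intro ballI)
  fix z :: complex assume z: "z \<in> sphere 0 1"
  have Arg_in: "Arg w \<in> {-pi..pi}" for w
    using Arg_bounded[of w] by auto
  show "continuous (at z within sphere 0 1) ?H"
  proof (cases "z = -1")
    case True
    have "bounded (f ` {-pi..pi})"
      by (intro compact_imp_bounded compact_continuous_image f) simp
    then obtain B where B: "\<And>x. x \<in> {-pi..pi} \<Longrightarrow> cmod (f x) \<le> B"
      by (meson bounded_iff imageI)
    have "((\<lambda>w. B * \<bar>1 + Re w\<bar>) \<longlongrightarrow> B * \<bar>1 + Re z\<bar>) (at z within sphere 0 1)"
      by (intro tendsto_intros)
    then have lim: "((\<lambda>w. B * \<bar>1 + Re w\<bar>) \<longlongrightarrow> 0) (at z within sphere 0 1)"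
      using True by simp
    have "(?H \<longlongrightarrow> 0) (at z within sphere 0 1)"
    proof (rule Lim_null_comparison[OF _ lim])
      show "\<forall>\<^sub>F w in at z within sphere 0 1. cmod (?H w) \<le> B * \<bar>1 + Re w\<bar>"
        by (intro always_eventually allI)
          (simp add: norm_mult mult_right_mono[OF B[OF Arg_in]] del: of_real_add)
    qed
    then show ?thesis
      using True by (simp add: continuous_within)
  next
    case False
    have "z \<notin> \<real>\<^sub>\<le>\<^sub>0"
    proof
      assume "z \<in> \<real>\<^sub>\<le>\<^sub>0"
      then obtain r where "z = of_real r" "r \<le> 0" by (auto elim: nonpos_Reals_cases)
      with z False show False by auto
    qed
    then have "continuous (at z within sphere 0 1) Arg"
      by (rule continuous_within_Arg)
    moreover have "continuous (at (Arg z) within Arg ` sphere 0 1) f"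
    proof (rule continuous_within_subset)
      show "continuous (at (Arg z) within {-pi..pi}) f"
        using f Arg_in by (simp only: continuous_on_eq_continuous_within)
    qed (use Arg_in in blast)
    ultimately have "continuous (at z within sphere 0 1) (\<lambda>w. f (Arg w))"
      by (rule continuous_within_compose2)
    moreover have "continuous (at z within sphere 0 1) Re"
      by (intro linear_continuous_within bounded_linear_Re)
    ultimately show ?thesis by (intro continuous_intros)
  qed
qed

text \<open>
  By the Stone-Weierstrass theorem on the circle, \<open>f\<close> is orthogonal to every continuous
  function of \<open>cis\<close>. Choosing the transfer of \<open>cnj f * (1 + cos)\<close> yields
  \<open>\<integral> |f|\<^sup>2 (1 + cos) = 0\<close>, so the continuous integrand vanishes, and \<open>f\<close> is zero in the interior.
\<close>
lemma null_fourier_coeffs_imp_zero: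
  assumes Z: "null_fourier_coeffs f" and x: "x \<in> {-pi..pi}"
  shows "f x = 0"
proof -
  define H where "H = (\<lambda>z. cnj (f (Arg z)) * of_real (1 + Re z))"
  define h where "h = (\<lambda>x. (cmod (f x))\<^sup>2 * (1 + cos x))"
  have f: "continuous_on {-pi..pi} f"
    using Z by (simp add: null_fourier_coeffs_def)
  have H: "continuous_on (sphere 0 1) H"
    unfolding H_def by (intro continuous_on_damped_transfer continuous_intros f)
  have h: "continuous_on {-pi..pi} h"
    unfolding h_def by (intro continuous_intros f)
  \<comment> \<open>At the left end \<open>Arg (cis y) \<noteq> y\<close>, but there both sides carry the factor \<open>1 + cos \<pi> = 0\<close>.\<close>
  have Hh: "H (cis y) * f y = of_real (h y)" if "y \<in> {-pi..pi}" for y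
  proof (cases "y = - pi")
    case True
    then show ?thesis by (simp add: H_def h_def)
  next
    case False
    with that have "Arg (cis y) = y" by (intro Arg_cis) auto
    then have "H (cis y) * f y = (f y * cnj (f y)) * of_real (1 + cos y)"
      by (simp add: H_def algebra_simps)
    also have "\<dots> = of_real (h y)"
      unfolding complex_norm_square[symmetric] h_def by simp
    finally show ?thesis .
  qed
  have "bounded (f ` {-pi..pi})"
    by (intro compact_imp_bounded compact_continuous_image f) simp
  then obtain B where B: "B > 0" "\<And>x. x \<in> {-pi..pi} \<Longrightarrow> cmod (f x) \<le> B"
    by (auto simp: bounded_pos)
  define I where "I = integral {-pi..pi} (\<lambda>y. complex_of_real (h y))"
  have "cmod I \<le> e" if "e > 0" for e
  proof -
    \<comment> \<open>An error \<open>d\<close> on the circle costs at most \<open>2\<pi> B d\<close> in the integral.\<close>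
    define d where "d = e / (2 * pi * B)"
    have "d > 0" using that B(1) by (simp add: d_def)
    then obtain g where g: "polynomial_function g" "\<forall>z\<in>sphere 0 1. cmod (H z - g z) < d"
      using Stone_Weierstrass_polynomial_function[OF compact_sphere H] by metis
    have gZ: "null_fourier_coeffs (\<lambda>y. g (cis y) * f y)"
      by (rule null_fourier_coeffs_mult_poly[OF g(1) Z])
    then have gc: "continuous_on {-pi..pi} (\<lambda>y. g (cis y) * f y)"
      by (simp add: null_fourier_coeffs_def)
    have "integral {-pi..pi} (\<lambda>y. g (cis y) * f y) = 0"
      using gZ unfolding null_fourier_coeffs_def by (metis (no_types, lifting) cis_zero
          integral_cong mult.right_neutral mult_zero_left of_int_0)
    moreover have "integral {-pi..pi} (\<lambda>y. of_real (h y) - g (cis y) * f y)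
        = I - integral {-pi..pi} (\<lambda>y. g (cis y) * f y)"
      unfolding I_def
      by (intro Henstock_Kurzweil_Integration.integral_diff integrable_continuous_real gc
          continuous_on_of_real h)
    ultimately have "cmod I = cmod (integral {-pi..pi} (\<lambda>y. of_real (h y) - g (cis y) * f y))"
      by simp
    also have "\<dots> \<le> (d * B) * (pi - - pi)"
    proof (rule integral_bound)
      show "continuous_on {-pi..pi} (\<lambda>y. of_real (h y) - g (cis y) * f y)"
        by (intro continuous_on_diff gc continuous_on_of_real h)
      fix y assume y: "y \<in> {-pi..pi}"
      have "cmod (of_real (h y) - g (cis y) * f y) = cmod (H (cis y) - g (cis y)) * cmod (f y)"
        by (simp add: Hh[OF y, symmetric] norm_mult flip: left_diff_distrib)
      also have "\<dots> \<le> d * B"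
        using g(2) B(2)[OF y] \<open>d > 0\<close> by (intro mult_mono) (auto intro: less_imp_le)
      finally show "cmod (of_real (h y) - g (cis y) * f y) \<le> d * B" .
    qed simp
    also have "\<dots> = e" using B(1) by (simp add: d_def)
    finally show ?thesis .
  qed
  then have "cmod I \<le> 0" by (meson dense_ge)
  then have "I = 0" by simp
  moreover have "Re I = integral {-pi..pi} h"
  proof -
    have "integral {-pi..pi} (Re \<circ> (\<lambda>y. complex_of_real (h y))) = Re I"
      unfolding I_def
      by (intro integral_linear bounded_linear_Re integrable_continuous_real continuous_on_of_real h)
    then show ?thesis by (simp add: o_def)
  qed
  ultimately have "integral {-pi..pi} h = 0" by simp
  moreover have "h y \<ge> 0" for y
    using cos_ge_minus_one[of y] unfolding h_def by (intro mult_nonneg_nonneg) (simp, linarith)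
  ultimately have h0: "h y = 0" if "y \<in> {-pi..pi}" for y
    using integral_eq_0_iff[OF h] that by (simp add: pi_gt_zero)
  have "f y = 0" if y: "y \<in> {-pi<..<pi}" for y
  proof -
    have "cos y > cos pi"
    proof (cases "y \<ge> 0")
      case True
      then show ?thesis using y by (intro cos_monotone_0_pi) auto
    next
      case False
      then have "cos (- y) > cos pi" using y by (intro cos_monotone_0_pi) auto
      then show ?thesis by simp
    qed
    then show ?thesis using h0[of y] y by (simp add: h_def)
  qed
  then show "f x = 0"
    using continuous_constant_on_closure[of "{-pi<..<pi}" f 0 x] f x
    by (simp add: closure_greaterThanLessThan)
qed

section \<open>Characteristic functions of integer-valued variables\<close>
lemma char_fun_eq_powi:
  assumes "X \<in> M \<rightarrow>\<^sub>M count_space UNIV"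
  shows "char_fun M X \<mu> = (CLINT \<omega>|M. cis \<mu> powi X \<omega>)"
  unfolding char_fun_eq_expectation[OF assms]
  by (simp add: cis_power_int) (simp add: cis_conv_exp mult_ac)

text \<open>
  This is \<open>2\<pi>\<close>-periodicity, in the form needed to carry an identity from \<open>[-\<pi>, \<pi>]\<close>
  to the whole line.
\<close>
lemma char_fun_Arg_cis:
  assumes "X \<in> M \<rightarrow>\<^sub>M count_space UNIV"
  shows "char_fun M X (Arg (cis \<mu>)) = char_fun M X \<mu>"
  unfolding char_fun_eq_powi[OF assms] by (simp add: cis_Arg)

lemma char_fun_minus:
  assumes "X \<in> M \<rightarrow>\<^sub>M count_space UNIV"
  shows "char_fun M X (- \<mu>) = cnj (char_fun M X \<mu>)"
proof -
  have "cis (- \<mu>) powi k = cnj (cis \<mu> powi k)" for k :: int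
    by (simp add: cis_cnj)
  then show ?thesis
    unfolding char_fun_eq_powi[OF assms] by (simp only: Bochner_Integration.integral_cnj)
qed

lemma real_distribution_of_int:
  assumes "prob_space M" and [measurable]: "X \<in> M \<rightarrow>\<^sub>M count_space UNIV"
  shows "real_distribution (distr M borel (\<lambda>\<omega>. real_of_int (X \<omega>)))"
proof -
  interpret prob_space M by fact
  show ?thesis by (rule real_distribution_distr) measurable
qed

text \<open>
  Levy's theorem speaks of distributions on the reals; taking the floor brings its conclusion
  back to the integers.
\<close>
lemma char_fun_inject:
  assumes "prob_space M" "prob_space N"
    and X [measurable]: "X \<in> M \<rightarrow>\<^sub>M count_space UNIV"
    and Y [measurable]: "Y \<in> N \<rightarrow>\<^sub>M count_space UNIV"
    and eq: "char_fun M X = char_fun N Y"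
  shows "distr M (count_space UNIV) X = distr N (count_space UNIV) Y"
proof -
  have "distr M borel (\<lambda>\<omega>. real_of_int (X \<omega>)) = distr N borel (\<lambda>\<omega>. real_of_int (Y \<omega>))"
    using eq unfolding char_fun_def by (intro Levy_uniqueness real_distribution_of_int assms)
  then have "distr (distr M borel (\<lambda>\<omega>. real_of_int (X \<omega>))) (count_space UNIV) floor
      = distr (distr N borel (\<lambda>\<omega>. real_of_int (Y \<omega>))) (count_space UNIV) floor"
    by simp
  moreover have "(floor :: real \<Rightarrow> int) \<in> borel \<rightarrow>\<^sub>M count_space UNIV"
    by measurable
  ultimately show ?thesis
    by (simp add: distr_distr o_def)
qed

lemma char_fun_cong_distr:
  assumes [measurable]: "X \<in> M \<rightarrow>\<^sub>M count_space UNIV" "Y \<in> N \<rightarrow>\<^sub>M count_space UNIV"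
    and eq: "distr M (count_space UNIV) X = distr N (count_space UNIV) Y"
  shows "char_fun M X = char_fun N Y"
proof -
  have "distr (distr M (count_space UNIV) X) borel real_of_int
      = distr (distr N (count_space UNIV) Y) borel real_of_int"
    using eq by simp
  then show ?thesis
    unfolding char_fun_def by (simp add: distr_distr o_def)
qed

lemma char_fun_poisson:
  assumes "rate > 0"
  shows "char_fun (poisson_pmf rate) int \<mu> = exp (of_real rate * (cis \<mu> - 1))"
proof -
  let ?f = "\<lambda>k. pmf (poisson_pmf rate) k *\<^sub>R cis \<mu> ^ k"
  have int: "integrable (count_space UNIV) ?f"
  proof (rule Bochner_Integration.integrable_bound)
    show "integrable (count_space UNIV) (pmf (poisson_pmf rate))"
      by (rule integrable_pmf)
  qed (auto simp: norm_power)
  have "(\<lambda>k. of_real (exp (- rate)) * ((of_real rate * cis \<mu>) ^ k /\<^sub>R fact k)) sums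
      (of_real (exp (- rate)) * exp (of_real rate * cis \<mu>))"
    by (intro sums_mult exp_converges)
  also have "(\<lambda>k. of_real (exp (- rate)) * ((of_real rate * cis \<mu>) ^ k /\<^sub>R fact k)) = ?f"
    using assms by (simp add: fun_eq_iff scaleR_conv_of_real power_mult_distrib field_simps)
  finally have sums: "?f sums (of_real (exp (- rate)) * exp (of_real rate * cis \<mu>))" .
  have "char_fun (poisson_pmf rate) int \<mu> = (CLINT k|poisson_pmf rate. cis \<mu> ^ k)"
    by (subst char_fun_eq_powi) simp_all
  also have "\<dots> = (CLINT k|count_space UNIV. ?f k)"
    unfolding measure_pmf_eq_density by (subst integral_density) auto
  also have "\<dots> = of_real (exp (- rate)) * exp (of_real rate * cis \<mu>)"
    using sums_integral_count_space_nat[OF int] sums by (rule sums_unique2)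
  also have "\<dots> = exp (of_real rate * (cis \<mu> - 1))"
    by (simp add: right_diff_distrib exp_diff exp_minus divide_inverse mult.commute flip: exp_of_real)
  finally show ?thesis .
qed

lemma poisson_distributed_iff_char_fun:
  assumes "prob_space M" and X [measurable]: "X \<in> M \<rightarrow>\<^sub>M count_space UNIV" and "rate > 0"
  shows "poisson_distributed M X rate \<longleftrightarrow>
    (\<forall>\<mu>. char_fun M X \<mu> = exp (of_real rate * (cis \<mu> - 1)))"
proof -
  have distr: "measure_pmf (map_pmf int (poisson_pmf rate))
      = distr (poisson_pmf rate) (count_space UNIV) int"
    by (rule map_pmf_rep_eq)
  have "distr M (count_space UNIV) X = distr (poisson_pmf rate) (count_space UNIV) int
      \<longleftrightarrow> char_fun M X = char_fun (poisson_pmf rate) int"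
    using char_fun_inject[of M "poisson_pmf rate" X int] char_fun_cong_distr[of X M int "poisson_pmf rate"]
      assms measure_pmf.prob_space_axioms by auto
  then show ?thesis
    using \<open>rate > 0\<close> unfolding poisson_distributed_def distr
    by (simp add: fun_eq_iff char_fun_poisson)
qed

section \<open>Logarithms of characteristic functions\<close>

text \<open>
  Any continuous logarithm that vanishes at \<open>0\<close> is the unwrapped one, since the
  unwrapped phase is unique.
\<close>
lemma log_char_fun_eqI:
  assumes "continuous_on UNIV G" "G 0 = 0" "\<And>\<mu>. char_fun M X \<mu> = exp (G \<mu>)"
  shows "log_char_fun M X = G"
proof -
  have "is_unwrapped_phase (char_fun M X) (\<lambda>\<mu>. Im (G \<mu>))"
    using assms unfolding is_unwrapped_phase_def
    by (auto intro!: continuous_intros simp: exp_eq_polar norm_mult)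
  then have "unwrapped_phase (char_fun M X) = (\<lambda>\<mu>. Im (G \<mu>))"
    unfolding unwrapped_phase_def
    by (intro the_equality is_unwrapped_phase_unique[of "char_fun M X"]) (auto simp: assms(3))
  then show ?thesis
    by (auto simp: fun_eq_iff log_char_fun_def assms(3) complex_eq_iff)
qed

lemma log_char_fun_properties:
  assumes "prob_space M" and X: "X \<in> M \<rightarrow>\<^sub>M count_space UNIV"
    and nz: "\<And>\<mu>. char_fun M X \<mu> \<noteq> 0"
  shows "continuous_on S (log_char_fun M X)"
    and "log_char_fun M X 0 = 0"
    and "exp (log_char_fun M X \<mu>) = char_fun M X \<mu>"
proof -
  interpret D: real_distribution "distr M borel (\<lambda>\<omega>. real_of_int (X \<omega>))"
    by (rule real_distribution_of_int) fact+
  have phase: "is_unwrapped_phase (char_fun M X) (unwrapped_phase (char_fun M X))"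
    unfolding unwrapped_phase_def
    by (rule theI'[OF ex1_unwrapped_phase_char_fun[OF assms]])
  have cont: "continuous_on S (char_fun M X)"
    using D.isCont_char by (auto simp: char_fun_def continuous_at_imp_continuous_on)
  have "continuous_on S (unwrapped_phase (char_fun M X))"
    using phase by (auto simp: is_unwrapped_phase_def intro: continuous_on_subset)
  then show "continuous_on S (log_char_fun M X)"
    unfolding log_char_fun_def[abs_def] by (intro continuous_intros cont) (simp_all add: nz)
  show "log_char_fun M X 0 = 0"
    using phase D.char_zero by (simp add: log_char_fun_def is_unwrapped_phase_def char_fun_def)
  have "exp (log_char_fun M X \<mu>)
      = of_real (cmod (char_fun M X \<mu>)) * cis (unwrapped_phase (char_fun M X) \<mu>)"
    using nz[of \<mu>] by (simp add: log_char_fun_def exp_add exp_of_real cis_conv_exp)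
  also have "\<dots> = char_fun M X \<mu>"
    using phase by (simp add: is_unwrapped_phase_def)
  finally show "exp (log_char_fun M X \<mu>) = char_fun M X \<mu>" .
qed

section \<open>Muculants\<close>

lemma integral_cis:
  "integral {-pi..pi} (\<lambda>x. cis (of_int n * x)) = (if n = 0 then 2 * of_real pi else 0)"
proof (cases "n = 0")
  case True
  then show ?thesis by (simp add: scaleR_conv_of_real)
next
  case False
  have "((\<lambda>x. cis (of_int n * x)) has_integral
      cis (of_int n * pi) / (\<i> * of_int n) - cis (of_int n * (- pi)) / (\<i> * of_int n)) {-pi..pi}"
  proof (rule fundamental_theorem_of_calculus)
    fix x assume "x \<in> {-pi..pi}"
    have "((\<lambda>x. exp (\<i> * of_int n * of_real x) / (\<i> * of_int n)) has_vector_derivative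
        exp (\<i> * of_int n * of_real x)) (at x within {-pi..pi})"
      using False by (auto intro!: derivative_eq_intros has_vector_derivative_real_field)
    then show "((\<lambda>x. cis (of_int n * x) / (\<i> * of_int n)) has_vector_derivative
        cis (of_int n * x)) (at x within {-pi..pi})"
      by (simp add: cis_conv_exp mult_ac)
  qed simp
  moreover have "cis (of_int n * (- pi)) = cis (of_int n * pi)"
    by (simp add: complex_eq_iff sin_int_times_real mult.commute[of _ pi])
  ultimately show ?thesis
    using False by (simp add: integral_unique)
qed
lemma muculant_eq_integral:
  assumes "continuous_on {-pi..pi} (log_char_fun M X)"
  shows "muculant M X n = integral {-pi..pi} (\<lambda>\<mu>. log_char_fun M X \<mu> * cis (of_int (- n) * \<mu>))
      / (2 * of_real pi)"
proof -
  let ?f = "\<lambda>\<mu>. log_char_fun M X \<mu> * cis (of_int (- n) * \<mu>)"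
  have "set_integrable lborel {-pi..pi} ?f"
    unfolding set_integrable_def
    by (intro borel_integrable_compact continuous_on_times_cis assms compact_Icc)
  then have "(CLINT \<mu>:{-pi..pi}|lborel. ?f \<mu>) = integral {-pi..pi} ?f"
    by (rule set_borel_integral_eq_integral)
  moreover have "exp (- (\<i> * of_real \<mu> * of_int n)) = cis (of_int (- n) * \<mu>)" for \<mu>
    by (simp add: cis_conv_exp mult_ac)
  ultimately show ?thesis
    unfolding muculant_def by simp
qed

lemma integral_affine_cis:
  "integral {-pi..pi} (\<lambda>\<mu>. (a + b * cis \<mu>) * cis (of_int (- n) * \<mu>))
    = 2 * of_real pi * (if n = 0 then a else if n = 1 then b else 0)"
proof -
  have "(a + b * cis \<mu>) * cis (of_int (- n) * \<mu>)
      = a * cis (of_int (- n) * \<mu>) + b * cis (of_int (1 - n) * \<mu>)" for \<mu>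
    by (simp add: algebra_simps cis_mult)
  moreover have "integral {-pi..pi} (\<lambda>\<mu>. a * cis (of_int (- n) * \<mu>) + b * cis (of_int (1 - n) * \<mu>))
      = integral {-pi..pi} (\<lambda>\<mu>. a * cis (of_int (- n) * \<mu>))
        + integral {-pi..pi} (\<lambda>\<mu>. b * cis (of_int (1 - n) * \<mu>))"
    by (intro Henstock_Kurzweil_Integration.integral_add integrable_continuous_real continuous_intros)
  ultimately show ?thesis
    by (simp only: integral_mult_right integral_cis) auto
qed

lemma muculant_poisson:
  assumes "prob_space M" "X \<in> M \<rightarrow>\<^sub>M count_space UNIV" "poisson_distributed M X rate"
  shows "muculant M X n = (if n = 0 then - of_real rate else if n = 1 then of_real rate else 0)"
proof -
  have "char_fun M X \<mu> = exp (- of_real rate + of_real rate * cis \<mu>)" for \<mu>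
    using assms poisson_distributed_iff_char_fun[OF assms(1,2), of rate]
    by (simp add: poisson_distributed_def algebra_simps)
  then have log: "log_char_fun M X = (\<lambda>\<mu>. - of_real rate + of_real rate * cis \<mu>)"
    by (intro log_char_fun_eqI) (auto intro!: continuous_intros)
  have "continuous_on {-pi..pi} (log_char_fun M X)"
    unfolding log by (intro continuous_intros)
  from muculant_eq_integral[OF this, of n] show ?thesis
    unfolding log integral_affine_cis by simp
qed

lemma poisson_if_muculants:
  assumes "prob_space M" and X: "X \<in> M \<rightarrow>\<^sub>M count_space UNIV"
    and nz: "\<And>\<mu>. char_fun M X \<mu> \<noteq> 0"
    and c1: "muculant M X 1 \<noteq> 0" and c: "\<And>n. n \<notin> {0, 1} \<Longrightarrow> muculant M X n = 0"
  shows "\<exists>rate>0. poisson_distributed M X rate"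
proof -
  note L = log_char_fun_properties[OF assms(1) X nz]
  define a where "a = muculant M X 0"
  define b where "b = muculant M X 1"
  have cont: "continuous_on {-pi..pi} (\<lambda>\<mu>. a + b * cis \<mu>)"
    by (intro continuous_intros)
  have "null_fourier_coeffs (\<lambda>\<mu>. log_char_fun M X \<mu> - (a + b * cis \<mu>))"
    unfolding null_fourier_coeffs_def
  proof (intro conjI allI)
    show "continuous_on {-pi..pi} (\<lambda>\<mu>. log_char_fun M X \<mu> - (a + b * cis \<mu>))"
      by (intro continuous_on_diff L cont)
    fix n :: int
    have "integral {-pi..pi} (\<lambda>\<mu>. (log_char_fun M X \<mu> - (a + b * cis \<mu>)) * cis (of_int n * \<mu>))
        = integral {-pi..pi} (\<lambda>\<mu>. log_char_fun M X \<mu> * cis (of_int n * \<mu>))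
          - integral {-pi..pi} (\<lambda>\<mu>. (a + b * cis \<mu>) * cis (of_int n * \<mu>))"
      unfolding left_diff_distrib
      by (intro Henstock_Kurzweil_Integration.integral_diff integrable_continuous_real
          continuous_on_times_cis L cont)
    also have "\<dots> = 2 * of_real pi * (muculant M X (- n)
        - (if - n = 0 then a else if - n = 1 then b else 0))"
      using muculant_eq_integral[OF L(1), of "- n"] integral_affine_cis[of a b "- n"]
      by (simp add: right_diff_distrib)
    also have "\<dots> = 0"
      using c[of "- n"] by (auto simp: a_def b_def)
    finally show "integral {-pi..pi}
        (\<lambda>\<mu>. (log_char_fun M X \<mu> - (a + b * cis \<mu>)) * cis (of_int n * \<mu>)) = 0" .
  qed
  then have log: "log_char_fun M X \<mu> = a + b * cis \<mu>" if "\<mu> \<in> {-pi..pi}" for \<mu>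
    using null_fourier_coeffs_imp_zero[OF _ that] by fastforce
  have "a = - b"
    using log[of 0] L(2) by (simp add: eq_neg_iff_add_eq_0)
  have Phi: "char_fun M X \<mu> = exp (b * (cis \<mu> - 1))" if "\<mu> \<in> {-pi..pi}" for \<mu>
    using L(3)[of \<mu>] log[OF that] \<open>a = - b\<close> by (simp add: algebra_simps)
  \<comment> \<open>\<open>|\<Phi>(\<plusminus>\<pi>/2)| = exp (- Re b \<minusplus> Im b)\<close>\<close>
  have "cmod (char_fun M X (- (pi / 2))) = cmod (char_fun M X (pi / 2))"
    by (simp only: char_fun_minus[OF X] complex_mod_cnj)
  moreover have "- (pi / 2) \<in> {-pi..pi}" "pi / 2 \<in> {-pi..pi}"
    using pi_gt_zero unfolding atLeastAtMost_iff by linarith+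
  ultimately have "Im b = 0"
    by (simp only: Phi norm_exp_eq_Re) simp
  then have b: "b = of_real (Re b)"
    by (simp add: complex_eq_iff)
  interpret D: real_distribution "distr M borel (\<lambda>\<omega>. real_of_int (X \<omega>))"
    by (rule real_distribution_of_int) fact+
  have "cmod (char_fun M X pi) \<le> 1"
    unfolding char_fun_def by (rule D.cmod_char_le_1)
  then have "Re b \<ge> 0"
    by (simp add: Phi norm_exp_eq_Re)
  moreover have "Re b \<noteq> 0"
    using c1 b by (auto simp flip: b_def)
  ultimately have "Re b > 0" by simp
  moreover have "char_fun M X \<mu> = exp (of_real (Re b) * (cis \<mu> - 1))" for \<mu>
  proof -
    have "char_fun M X \<mu> = char_fun M X (Arg (cis \<mu>))"
      by (rule char_fun_Arg_cis[OF X, symmetric])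
    also have "\<dots> = exp (b * (cis (Arg (cis \<mu>)) - 1))"
      using Arg_bounded[of "cis \<mu>"] by (intro Phi) auto
    also have "\<dots> = exp (of_real (Re b) * (cis \<mu> - 1))"
      using b by (simp add: cis_Arg)
    finally show ?thesis .
  qed
  ultimately show ?thesis
    using poisson_distributed_iff_char_fun[OF assms(1) X] by blast
qed

theorem mainTheorem2:
  fixes M :: "'a measure" and X :: "'a \<Rightarrow> int"
  assumes "prob_space M"
    and "X \<in> M \<rightarrow>\<^sub>M count_space UNIV"
    and "\<And>\<mu>. char_fun M X \<mu> \<noteq> 0"
  shows "(\<forall>rate>0. poisson_distributed M X rate \<longrightarrow>
            muculant M X 0 = - of_real rate \<and> muculant M X 1 = of_real rate \<and>
            (\<forall>n. n \<notin> {0, 1} \<longrightarrow> muculant M X n = 0)) \<and>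
         (muculant M X 0 \<noteq> 0 \<and> muculant M X 1 \<noteq> 0 \<and>
            (\<forall>n. n \<notin> {0, 1} \<longrightarrow> muculant M X n = 0) \<longrightarrow>
            (\<exists>rate>0. poisson_distributed M X rate))"
  using muculant_poisson[OF assms(1,2)] poisson_if_muculants[OF assms] by auto

end
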